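(* Let $d>1$ and let $\epsilon_1>\epsilon_2>\dots>\epsilon_d>0$ with $\epsilon_j=\mathcal{O}(1)$ for all $j\in[d]$. Put $z_j=\frac{1}{e^{\epsilon_j}+1}$ and $$q_j=\begin{cases}z_j&\text{if }j=1,\\ \dfrac{z_j-z_{j-1}}{1-2z_{j-1}}&\text{if }j>1.\end{cases}$$ There exists a private multi-level mechanism using a total amount of randomness per user equal to $R_{\text{total}}^{\text{proposed}}=\sum_{j=1}^{d}H_2(q_j)$, such that for every $j\in[d]$ the $j$th analyst achieves the minimum risk estimation $r^{\ell_2^2}_{\epsilon_j,\infty,n,k}=\Theta\!\left(\frac{k}{n\epsilon_j^2}\right)$ (order-wise), while the privacy of each user is preserved with privacy level $\epsilon_j$ against the $j$th analyst. Explicitly: each user $i\in[n]$ has a random key $U_i$ with $H(U_i)=\sum_{j=1}^d H_2(q_j)$, publishes a single output $Y_i$ that is a function of $(X_i,U_i)$ and is seen by all analysts, and gives analyst $j$ a part $L_i^j$ of the key (a function of $U_i$); for every $j\in[d]$, the map from $X_i$ to what analyst $j$ sees, $(Y_i,L_i^j)$, is $\epsilon_j$-LDP, and there is an estimator $\hat{\mathbf{p}}^j$, a function of $(Y_i,L_i^j)_{i\in[n]}$, with $\sup_{\mathbf{p}\in\Delta_k}\mathbb{E}\|\hat{\mathbf{p}}^j-\mathbf{p}\|_2^2=\mathcal{O}\!\left(\frac{k}{n\epsilon_j^2}\right)$, which is the order of the minimum $r^{\ell_2^2}_{\epsilon_j,\infty,n,k}$.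
   Context: Entropies are in bits; $H_2(p)=-p\log p-(1-p)\log(1-p)$. The notation $\epsilon_j=\mathcal{O}(1)$ means bounded above by a fixed constant; constants hidden in $\Theta,\mathcal{O}$ may depend only on that bound. $[d]=\{1,\dots,d\}$. There are $n$ users; user $i$ holds $X_i\in[k]$, with $X_1,\dots,X_n$ i.i.d. from an unknown $\mathbf{p}\in\Delta_k$ (the probability simplex over $[k]$). The keys $U_1,\dots,U_n$ are discrete random variables, independent of each other and of the data. A (randomized) map $Q(y|x)$ from $[k]$ to a finite alphabet is $\epsilon$-LDP if $Q(y|x)\le e^{\epsilon}Q(y|x')$ for all $x,x'\in[k]$ and all $y$. The quantity $r^{\ell_2^2}_{\epsilon,\infty,n,k}=\inf_{Q_1,\dots,Q_n}\inf_{\hat{\mathbf p}}\sup_{\mathbf p\in\Delta_k}\mathbb{E}\|\hat{\mathbf p}(Y^n)-\mathbf p\|_2^2$ is the minimax risk over all $\epsilon$-LDP mechanisms $Q_1,\dots,Q_n$ (no randomness constraint), where $Y_i$ is the output of $Q_i$ on $X_i$, independently across users, and $\hat{\mathbf p}$ ranges over functions of $Y^n=(Y_1,\dots,Y_n)$ with values in $\mathbb{R}^k$.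
   Formalization: The lower half of r = Θ(k/(nε_j²)) is asserted only for k ≥ 2 and nε_j² ≥ k²; for all n, k it is false (the risk is 0 for k = 1 and never exceeds 1, while k/(nε_j²) can be arbitrarily large). *)

theory Defs
  imports "HOL-Probability.Probability"
begin

definition H2 :: "real \<Rightarrow> real" where
  "H2 p = - p * log 2 p - (1 - p) * log 2 (1 - p)"

definition flip_prob :: "real \<Rightarrow> real" where
  "flip_prob \<epsilon> = 1 / (exp \<epsilon> + 1)"

definition key_bit_prob :: "(nat \<Rightarrow> real) \<Rightarrow> nat \<Rightarrow> real" where
  "key_bit_prob \<epsilon> j = (if j = 1 then flip_prob (\<epsilon> j)
            else (flip_prob (\<epsilon> j) - flip_prob (\<epsilon> (j - 1))) / (1 - 2 * flip_prob (\<epsilon> (j - 1))))"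

text \<open>Shannon entropy in bits of a discrete random variable with law \<open>K\<close>:
  the library's entropy, with respect to counting measure, of the identity on \<open>K\<close>.
  (If the entropy is infinite, this evaluates to \<open>0\<close>, the integral not being defined.)\<close>

definition entropy_bits :: "'u pmf \<Rightarrow> real" where
  "entropy_bits K = prob_space.entropy (measure_pmf K) 2 (count_space UNIV) (\<lambda>u. u)"

text \<open>Distributions on \<open>{1..k}\<close>.\<close>

definition prob_simplex :: "nat \<Rightarrow> nat pmf set" where
  "prob_simplex k = {p. set_pmf p \<subseteq> {1..k}}"

text \<open>A channel from \<open>{1..k}\<close> is a function \<open>x \<mapsto> Q(\<cdot>|x)\<close>; its values outside \<open>{1..k}\<close> are
  irrelevant. Its output alphabet has to be finite.\<close>

definition ldp :: "real \<Rightarrow> nat \<Rightarrow> (nat \<Rightarrow> 'y pmf) \<Rightarrow> bool" where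
  "ldp \<epsilon> k Q \<longleftrightarrow> finite (\<Union>x\<in>{1..k}. set_pmf (Q x)) \<and>
     (\<forall>x\<in>{1..k}. \<forall>x'\<in>{1..k}. \<forall>y. pmf (Q x) y \<le> exp \<epsilon> * pmf (Q x') y)"

text \<open>Joint law of what is observed from users \<open>1,\<dots>,n\<close>, where user \<open>i\<close> applies the channel
  \<open>Q i\<close> to an independent sample from \<open>p\<close>; coordinates outside \<open>{1..n}\<close> are constant.\<close>

definition observation_law :: "nat \<Rightarrow> (nat \<Rightarrow> nat \<Rightarrow> 'y pmf) \<Rightarrow> nat pmf \<Rightarrow> (nat \<Rightarrow> 'y) pmf" where
  "observation_law n Q p = Pi_pmf {1..n} undefined (\<lambda>i. bind_pmf p (Q i))"

text \<open>Risks take values in \<^typ>\<open>ennreal\<close>, so that expectations, suprema and infima always exist.\<close>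

definition worst_case_risk ::
    "nat \<Rightarrow> nat \<Rightarrow> (nat \<Rightarrow> nat \<Rightarrow> 'y pmf) \<Rightarrow> ((nat \<Rightarrow> 'y) \<Rightarrow> nat \<Rightarrow> real) \<Rightarrow> ennreal" where
  "worst_case_risk n k Q est =
     (\<Squnion>p\<in>prob_simplex k.
        \<integral>\<^sup>+ y. ennreal (\<Sum>a=1..k. (est y a - pmf p a)\<^sup>2) \<partial>measure_pmf (observation_law n Q p))"

text \<open>Every finite output alphabet embeds into \<^typ>\<open>nat\<close>, so channels with outputs in
  \<^typ>\<open>nat\<close> cover all mechanisms.\<close>

definition minimax_risk :: "real \<Rightarrow> nat \<Rightarrow> nat \<Rightarrow> ennreal" where
  "minimax_risk \<epsilon> n k =
     (\<Sqinter>Q\<in>{Q :: nat \<Rightarrow> nat \<Rightarrow> nat pmf. \<forall>i\<in>{1..n}. ldp \<epsilon> k (Q i)}.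
        \<Sqinter>est. worst_case_risk n k Q est)"

text \<open>A user draws a key \<open>U\<close> with law \<open>K\<close>, independently of the data, publishes \<open>f x U\<close> when
  holding \<open>x\<close>, and reveals \<open>l U\<close> to an analyst. The analyst's view, as a channel from \<open>x\<close>:\<close>

definition analyst_view ::
    "'u pmf \<Rightarrow> (nat \<Rightarrow> 'u \<Rightarrow> 'y) \<Rightarrow> ('u \<Rightarrow> 'l) \<Rightarrow> nat \<Rightarrow> ('y \<times> 'l) pmf" where
  "analyst_view K f l x = map_pmf (\<lambda>u. (f x u, l u)) K"

end

theory Submission
  imports Defs
begin

text \<open>The key consists of independent bits \<open>U\<^sub>1,\<dots>,U\<^sub>d\<close> with \<open>P(U\<^sub>j = 1) = q\<^sub>j\<close>, where the \<open>q\<^sub>j\<close> solve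
  \<open>z\<^sub>j = z\<^sub>j\<^sub>-\<^sub>1 (1 - q\<^sub>j) + (1 - z\<^sub>j\<^sub>-\<^sub>1) q\<^sub>j\<close>; hence \<open>U\<^sub>1 \<oplus> \<dots> \<oplus> U\<^sub>j\<close> is Bernoulli with parameter \<open>z\<^sub>j\<close>.
  A user publishes one bit of the Hadamard code word of his datum, masked by \<open>U\<^sub>1 \<oplus> \<dots> \<oplus> U\<^sub>d\<close>, and
  analyst \<open>j\<close> gets \<open>U\<^sub>j\<^sub>+\<^sub>1,\<dots>,U\<^sub>d\<close>, so that he sees randomized response with flip probability \<open>z\<^sub>j\<close>
  together with independent noise. Spreading the users evenly over \<open>\<Theta>(k)\<close> code positions and inverting
  the Hadamard transform estimates each mass with variance \<open>\<O>(1 / (n (1 - 2 z\<^sub>j)\<^sup>2))\<close>.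

  The lower bound is Assouad's method. Shifting mass \<open>\<Delta>\<close> between two symbols changes the output law of
  an \<open>\<epsilon>\<close>-LDP channel by a relative amount \<open>\<eta> = \<O>(\<Delta> \<epsilon>)\<close>, so the Hellinger affinity of two neighbouring
  hypotheses after \<open>n\<close> users is at least \<open>1 - n \<eta>\<^sup>2 / 4\<close>, which is bounded below for \<open>\<Delta> \<approx> 1 / (\<epsilon> sqrt n)\<close>.\<close>

section \<open>Entropy and parity of the key\<close>

text \<open>\<open>pmf K\<close> is the density of the identity with respect to counting measure;
  finite support makes the entropy integral a finite sum.\<close>

lemma entropy_bits_finite:
  assumes fin: "finite (set_pmf K)"
  shows "entropy_bits K = - (\<Sum>u\<in>set_pmf K. pmf K u * log 2 (pmf K u))"
proof -
  interpret information_space "measure_pmf K" 2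
    by unfold_locales auto
  have "distr (measure_pmf K) (count_space UNIV) (\<lambda>u. u) = measure_pmf K"
    by (rule measure_eqI) (auto simp: emeasure_distr)
  then have "distributed (measure_pmf K) (count_space UNIV) (\<lambda>u. u) (pmf K)"
    unfolding distributed_def by (simp add: measure_pmf_eq_density[symmetric])
  then have "entropy_bits K = - (\<integral>u. pmf K u * log 2 (pmf K u) \<partial>count_space UNIV)"
    unfolding entropy_bits_def by (subst entropy_distr) auto
  also have "(\<integral>u. pmf K u * log 2 (pmf K u) \<partial>count_space UNIV) = (\<Sum>u\<in>set_pmf K. pmf K u * log 2 (pmf K u))"
    by (subst lebesgue_integral_count_space_finite_support)
       (auto simp: set_pmf_iff intro!: finite_subset[OF _ fin] sum.mono_neutral_left)
  finally show ?thesis .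
qed

lemma entropy_bits_map_inj:
  assumes "finite (set_pmf K)" "inj f"
  shows "entropy_bits (map_pmf f K) = entropy_bits K"
  using assms
  by (simp add: entropy_bits_finite sum.reindex inj_on_subset[OF assms(2)] pmf_map_inj')

text \<open>Sums run over the supports, where both masses are positive and the logarithm of their
  product splits; in each half the other law sums to one.\<close>

lemma entropy_bits_pair:
  assumes fin: "finite (set_pmf K)" "finite (set_pmf M)"
  shows "entropy_bits (pair_pmf K M) = entropy_bits K + entropy_bits M"
proof -
  let ?h = "\<lambda>P x. pmf P x * log 2 (pmf P x)"
  have s: "(\<Sum>x\<in>set_pmf K. pmf K x) = 1" "(\<Sum>x\<in>set_pmf M. pmf M x) = 1"
    using fin by (auto intro: sum_pmf_eq_1)
  have "(\<Sum>z\<in>set_pmf (pair_pmf K M). ?h (pair_pmf K M) z)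
      = (\<Sum>x\<in>set_pmf K. \<Sum>y\<in>set_pmf M. ?h K x * pmf M y + pmf K x * ?h M y)"
    by (auto simp: sum.cartesian_product pmf_pair log_mult pmf_pos set_pmf_iff algebra_simps intro!: sum.cong)
  also have "\<dots> = (\<Sum>x\<in>set_pmf K. ?h K x) + (\<Sum>y\<in>set_pmf M. ?h M y)"
    using s by (simp add: sum.distrib flip: sum_distrib_left sum_distrib_right)
  finally show ?thesis using fin by (simp add: entropy_bits_finite)
qed

lemma entropy_bits_bernoulli:
  assumes "0 < q" "q < 1"
  shows "entropy_bits (bernoulli_pmf q) = H2 q"
  using assms by (simp add: entropy_bits_finite H2_def UNIV_bool)

primrec bits_pmf :: "real list \<Rightarrow> bool list pmf" where
  "bits_pmf [] = return_pmf []"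
| "bits_pmf (q # qs) = map_pmf (\<lambda>(b, w). b # w) (pair_pmf (bernoulli_pmf q) (bits_pmf qs))"

lemma finite_set_bits_pmf: "finite (set_pmf (bits_pmf qs))"
  by (induction qs) auto

lemma entropy_bits_bits_pmf:
  assumes "\<And>q. q \<in> set qs \<Longrightarrow> 0 < q \<and> q < 1"
  shows "entropy_bits (bits_pmf qs) = (\<Sum>q\<leftarrow>qs. H2 q)"
  using assms
proof (induction qs)
  case Nil
  show ?case by (simp add: entropy_bits_finite)
next
  case (Cons q qs)
  have "inj (\<lambda>(b :: bool, w). b # w)" by (auto simp: inj_def)
  with Cons show ?case
    by (simp add: entropy_bits_map_inj entropy_bits_pair entropy_bits_bernoulli finite_set_bits_pmf)
qed

lemma bits_pmf_append:
  "bits_pmf (qs @ rs) = map_pmf (\<lambda>(u, w). u @ w) (pair_pmf (bits_pmf qs) (bits_pmf rs))"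
proof (induction qs)
  case Nil
  show ?case by (simp add: pair_return_pmf1 map_pmf_comp)
next
  case (Cons q qs)
  show ?case unfolding append_Cons bits_pmf.simps Cons
    by (simp add: pair_pmf_def map_pmf_def bind_assoc_pmf bind_return_pmf)
qed

lemma length_bits_pmf: "w \<in> set_pmf (bits_pmf qs) \<Longrightarrow> length w = length qs"
  by (induction qs arbitrary: w) auto

section \<open>Parity of independent biased bits\<close>

definition parity :: "bool list \<Rightarrow> bool" where
  "parity w = foldr (\<noteq>) w False"

lemma parity_simps [simp]: "parity [] = False" "parity (b # w) = (b \<noteq> parity w)"
  by (simp_all add: parity_def)

lemma parity_append [simp]: "parity (u @ w) = (parity u \<noteq> parity w)"
  by (induction u) auto

lemma bernoulli_xor:
  assumes "0 \<le> p" "p \<le> 1" "0 \<le> q" "q \<le> 1"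
  shows "map_pmf (\<lambda>(a, b). a \<noteq> b) (pair_pmf (bernoulli_pmf p) (bernoulli_pmf q))
       = bernoulli_pmf (p * (1 - q) + (1 - p) * q)" (is "?M = _")
proof -
  let ?r = "p * (1 - q) + (1 - p) * q"
  \<comment> \<open>\<open>bernoulli_pmf\<close> clamps its argument to the unit interval, so
    \<open>?r\<close> must be placed there before its masses can be read off.\<close>
  have r: "0 \<le> ?r" using assms by simp
  have "1 - ?r = p * q + (1 - p) * (1 - q)" by (simp add: algebra_simps)
  also have "\<dots> \<ge> 0" using assms by simp
  finally have r1: "?r \<le> 1" by simp
  have "?M = bernoulli_pmf p \<bind> (\<lambda>a. bernoulli_pmf q \<bind> (\<lambda>b. return_pmf (a \<noteq> b)))"
    by (simp add: pair_pmf_def map_pmf_def bind_assoc_pmf bind_return_pmf)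
  then have "pmf ?M x = pmf (bernoulli_pmf ?r) x" for x
    using assms r r1 by (cases x) (auto simp: pmf_bind algebra_simps)
  then show ?thesis by (rule pmf_eqI)
qed

lemma map_parity_bits_pmf_append:
  assumes "map_pmf parity (bits_pmf qs) = bernoulli_pmf p"
    and "0 \<le> p" "p \<le> 1" "0 \<le> q" "q \<le> 1"
  shows "map_pmf parity (bits_pmf (qs @ [q])) = bernoulli_pmf (p * (1 - q) + (1 - p) * q)"
proof -
  have "map_pmf parity (bits_pmf (qs @ [q]))
      = map_pmf (\<lambda>(a, b). a \<noteq> b) (pair_pmf (map_pmf parity (bits_pmf qs)) (bernoulli_pmf q))"
    unfolding bits_pmf_append
    by (simp add: pair_pmf_def map_pmf_def bind_assoc_pmf bind_return_pmf)
  also have "\<dots> = bernoulli_pmf (p * (1 - q) + (1 - p) * q)"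
    unfolding assms(1) using assms(2-5) by (rule bernoulli_xor)
  finally show ?thesis .
qed

lemma flip_prob_bounds: "0 < e \<Longrightarrow> 0 < flip_prob e \<and> flip_prob e < 1 / 2"
  using exp_gt_one[of e] by (simp add: flip_prob_def add_pos_pos divide_less_eq)

text \<open>Decreasing \<open>\<epsilon>\<close> makes the flip probabilities increase strictly
  while staying below 1/2; the quotient is below 1 because two such probabilities sum to less than
  1. The entropy formula for a bit asks for these strict bounds.\<close>

lemma key_bit_prob_bounds:
  assumes "strict_antimono_on {1..d} \<epsilon>" "\<And>j. j \<in> {1..d} \<Longrightarrow> 0 < \<epsilon> j" "j \<in> {1..d}"
  shows "0 < key_bit_prob \<epsilon> j \<and> key_bit_prob \<epsilon> j < 1"
proof (cases "j = 1")
  case True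
  then show ?thesis using flip_prob_bounds[of "\<epsilon> 1"] assms by (simp add: key_bit_prob_def)
next
  case False
  then have j: "j - 1 \<in> {1..d}" "j - 1 < j" using assms(3) by auto
  then have "\<epsilon> j < \<epsilon> (j - 1)" using assms(1,3) by (auto simp: monotone_on_def)
  then have "flip_prob (\<epsilon> (j - 1)) < flip_prob (\<epsilon> j)"
    by (auto simp: flip_prob_def add_pos_pos intro!: divide_strict_left_mono)
  moreover have "flip_prob (\<epsilon> (j - 1)) < 1 / 2" "flip_prob (\<epsilon> j) < 1 / 2"
    "0 < flip_prob (\<epsilon> (j - 1))" "0 < flip_prob (\<epsilon> j)"
    using flip_prob_bounds j assms by blast+
  ultimately show ?thesis using False by (auto simp: key_bit_prob_def field_simps)
qed

lemma map_parity_key_bits: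
  assumes "strict_antimono_on {1..d} \<epsilon>" "\<And>j. j \<in> {1..d} \<Longrightarrow> 0 < \<epsilon> j" "1 \<le> j" "j \<le> d"
  shows "map_pmf parity (bits_pmf (map (key_bit_prob \<epsilon>) [1..<Suc j])) = bernoulli_pmf (flip_prob (\<epsilon> j))"
  using assms(3,4)
proof (induction j rule: dec_induct)
  case base
  \<comment> \<open>The empty list has parity law Bernoulli(0), so the first bit is an instance of
    appending.\<close>
  have "map_pmf parity (bits_pmf ([] @ [key_bit_prob \<epsilon> 1]))
     = bernoulli_pmf (0 * (1 - key_bit_prob \<epsilon> 1) + (1 - 0) * key_bit_prob \<epsilon> 1)"
    using key_bit_prob_bounds[OF assms(1,2), of 1] base
    by (intro map_parity_bits_pmf_append) (auto intro!: pmf_eqI simp: pmf_bernoulli_True split: split_indicator)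
  then show ?case by (simp add: key_bit_prob_def)
next
  case (step j)
  have fb: "flip_prob (\<epsilon> j) > 0" "flip_prob (\<epsilon> j) < 1 / 2"
    using flip_prob_bounds[of "\<epsilon> j"] assms(2)[of j] step by auto
  have kb: "0 < key_bit_prob \<epsilon> (Suc j)" "key_bit_prob \<epsilon> (Suc j) < 1"
    using key_bit_prob_bounds[OF assms(1,2), of "Suc j"] step by auto
  have "map_pmf parity (bits_pmf (map (key_bit_prob \<epsilon>) [1..<Suc j] @ [key_bit_prob \<epsilon> (Suc j)]))
    = bernoulli_pmf (flip_prob (\<epsilon> j) * (1 - key_bit_prob \<epsilon> (Suc j)) + (1 - flip_prob (\<epsilon> j)) * key_bit_prob \<epsilon> (Suc j))"
    using step fb kb by (intro map_parity_bits_pmf_append) auto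
  also have "flip_prob (\<epsilon> j) * (1 - key_bit_prob \<epsilon> (Suc j)) + (1 - flip_prob (\<epsilon> j)) * key_bit_prob \<epsilon> (Suc j)
    = flip_prob (\<epsilon> j) + (1 - 2 * flip_prob (\<epsilon> j)) * key_bit_prob \<epsilon> (Suc j)"
    by (simp add: algebra_simps)
  \<comment> \<open>\<open>key_bit_prob\<close> solves this linear equation; its denominator is
    positive since \<open>flip_prob (\<epsilon> j)\<close> is below 1/2.\<close>
  also have "\<dots> = flip_prob (\<epsilon> (Suc j))"
    using step fb by (simp add: key_bit_prob_def)
  finally show ?case using step by simp
qed

section \<open>Privacy of the masked bit\<close>

lemma pmf_bind_bernoulli:
  assumes "0 \<le> p" "p \<le> 1"
  shows "pmf (bernoulli_pmf p \<bind> R) y = p * pmf (R True) y + (1 - p) * pmf (R False) y"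
  using assms by (simp add: pmf_bind)

text \<open>Binary randomized response with flip probability \<open>flip_prob e\<close>.\<close>

definition noisy_bit :: "real \<Rightarrow> bool \<Rightarrow> bool pmf" where
  "noisy_bit e b = bernoulli_pmf (if b then 1 - flip_prob e else flip_prob e)"

lemma map_xor_bernoulli_flip_prob:
  assumes "0 < e"
  shows "map_pmf (\<lambda>t. b \<noteq> t) (bernoulli_pmf (flip_prob e)) = noisy_bit e b"
proof -
  have z: "0 < flip_prob e" "flip_prob e < 1" using flip_prob_bounds[OF assms] by auto
  have "pmf (map_pmf (\<lambda>t. b \<noteq> t) (bernoulli_pmf (flip_prob e))) x = pmf (noisy_bit e b) x" for x
    using z by (cases x; cases b) (auto simp: noisy_bit_def map_pmf_def pmf_bind)
  then show ?thesis by (rule pmf_eqI)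
qed

text \<open>The worst case is an equality:
  \<open>exp e * flip_prob e = 1 - flip_prob e\<close>.\<close>

lemma noisy_bit_ratio:
  assumes "0 < e"
  shows "pmf (noisy_bit e b) x \<le> exp e * pmf (noisy_bit e b') x"
proof -
  have z: "0 < flip_prob e" "flip_prob e < 1 / 2" using flip_prob_bounds[OF assms] by auto
  have "exp e + 1 > 0" by (simp add: add_pos_pos)
  then have ez: "exp e * flip_prob e = 1 - flip_prob e" by (simp add: flip_prob_def field_simps)
  have e1: "exp e \<ge> 1" using assms by simp
  have e2: "1 - flip_prob e \<le> exp e * (1 - flip_prob e)" "flip_prob e \<le> exp e * flip_prob e"
    using mult_right_mono[OF e1, of "1 - flip_prob e"] mult_right_mono[OF e1, of "flip_prob e"] z by simp_all
  then have "flip_prob e \<le> exp e * (1 - flip_prob e)" using z by linarith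
  with z ez e2 show ?thesis
    by (cases x; cases b; cases b') (auto simp: noisy_bit_def)
qed

text \<open>Post-processing: each output mass is a nonnegative combination of the two masses of the
  noisy bit, so the ratio bound carries over.\<close>

lemma ldp_noisy_bit_bind:
  assumes "0 < e" and fin: "\<And>t. finite (set_pmf (R t))"
  shows "ldp e k (\<lambda>x. noisy_bit e (h x) \<bind> R)"
proof -
  have z: "0 < flip_prob e" "flip_prob e < 1" using flip_prob_bounds[OF assms(1)] by auto
  have split: "pmf (noisy_bit e b \<bind> R) y
      = pmf (noisy_bit e b) True * pmf (R True) y + pmf (noisy_bit e b) False * pmf (R False) y" for b y
    using z by (auto simp: noisy_bit_def pmf_bind_bernoulli)
  have "pmf (noisy_bit e b \<bind> R) y \<le> exp e * pmf (noisy_bit e b' \<bind> R) y" for b b' y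
  proof -
    have "pmf (noisy_bit e b \<bind> R) y
        \<le> exp e * pmf (noisy_bit e b') True * pmf (R True) y + exp e * pmf (noisy_bit e b') False * pmf (R False) y"
      unfolding split by (intro add_mono mult_right_mono noisy_bit_ratio assms(1)) auto
    then show ?thesis by (simp add: split algebra_simps)
  qed
  moreover have "(\<Union>x\<in>{1..k}. set_pmf (noisy_bit e (h x) \<bind> R)) \<subseteq> set_pmf (R True) \<union> set_pmf (R False)"
    by (auto simp: set_bind_pmf) (metis (full_types))
  ultimately show ?thesis
    unfolding ldp_def using finite_subset fin by blast
qed

section \<open>What an analyst sees and can decode\<close>

definition masked_bit :: "(nat \<Rightarrow> bool) \<Rightarrow> nat \<Rightarrow> nat \<Rightarrow> nat" where
  "masked_bit h x u = of_bool (h x \<noteq> parity (from_nat u))"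

definition key_suffix :: "nat \<Rightarrow> nat \<Rightarrow> nat" where
  "key_suffix j u = to_nat (drop j (from_nat u :: bool list))"

text \<open>The revealed suffix cancels its share of the mask, leaving the datum's bit masked by the
  hidden prefix.\<close>

definition unmask :: "nat \<times> nat \<Rightarrow> bool" where
  "unmask = (\<lambda>(y, l). (y = 1) \<noteq> parity (from_nat l))"

text \<open>The mask is the exclusive or of the parities of the hidden prefix and the revealed
  suffix. The two are independent, so the prefix alone acts as randomized response and the rest is
  post-processing by fresh noise.\<close>

lemma analyst_view_masked_bit:
  assumes len: "length qs = j"
    and par: "map_pmf parity (bits_pmf qs) = bernoulli_pmf (flip_prob e)" and "0 < e"
  shows "analyst_view (map_pmf to_nat (bits_pmf (qs @ rs))) (masked_bit h) (key_suffix j) x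
    = noisy_bit e (h x) \<bind> (\<lambda>t. map_pmf (\<lambda>w. (of_bool (t \<noteq> parity w), to_nat w)) (bits_pmf rs))"
proof -
  have "analyst_view (map_pmf to_nat (bits_pmf (qs @ rs))) (masked_bit h) (key_suffix j) x
    = bits_pmf qs \<bind> (\<lambda>u. map_pmf (\<lambda>w. (of_bool (h x \<noteq> parity (u @ w)), to_nat (drop j (u @ w)))) (bits_pmf rs))"
    unfolding analyst_view_def bits_pmf_append masked_bit_def key_suffix_def
    by (simp add: pair_pmf_def map_pmf_def bind_assoc_pmf bind_return_pmf)
  also have "\<dots> = bits_pmf qs \<bind> (\<lambda>u. map_pmf (\<lambda>w. (of_bool ((h x \<noteq> parity u) \<noteq> parity w), to_nat w)) (bits_pmf rs))"
    using len by (intro bind_pmf_cong refl map_pmf_cong) (auto dest!: length_bits_pmf)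
  also have "\<dots> = map_pmf (\<lambda>t. h x \<noteq> t) (map_pmf parity (bits_pmf qs)) \<bind>
      (\<lambda>t. map_pmf (\<lambda>w. (of_bool (t \<noteq> parity w), to_nat w)) (bits_pmf rs))"
    by (simp add: bind_map_pmf)
  finally show ?thesis unfolding par map_xor_bernoulli_flip_prob[OF assms(3)] .
qed

lemma map_unmask_view:
  "map_pmf unmask (noisy_bit e b \<bind> (\<lambda>t. map_pmf (\<lambda>w. (of_bool (t \<noteq> parity w), to_nat w)) (bits_pmf rs)))
    = noisy_bit e b"
proof -
  have "unmask (of_bool (t \<noteq> parity w), to_nat w) = t" for t w
    by (auto simp: unmask_def)
  show ?thesis
    by (simp only: map_bind_pmf map_pmf_comp \<open>\<And>t w. unmask (of_bool (t \<noteq> parity w), to_nat w) = t\<close>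
        map_pmf_const bind_return_pmf')
qed

section \<open>Estimation from Hadamard bits\<close>

text \<open>Sylvester's matrix of order \<open>2 ^ m\<close>: the entry is -1 to the power of the
  inner product of the lowest \<open>m\<close> binary digits of \<open>s\<close> and
  \<open>x\<close>.\<close>

primrec hadamard :: "nat \<Rightarrow> nat \<Rightarrow> nat \<Rightarrow> real" where
  "hadamard 0 s x = 1"
| "hadamard (Suc m) s x = (if odd s \<and> odd x then - 1 else 1) * hadamard m (s div 2) (x div 2)"

lemma hadamard_cases: "hadamard m s x = 1 \<or> hadamard m s x = - 1"
  by (induction m arbitrary: s x) auto

lemma hadamard_sq [simp]: "(hadamard m s x)\<^sup>2 = 1"
  using hadamard_cases[of m s x] by auto

lemma sum_lessThan_double:
  fixes f :: "nat \<Rightarrow> real"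
  shows "(\<Sum>s<2 * n. f s) = (\<Sum>t<n. f (2 * t) + f (2 * t + 1))"
  by (induction n) auto

text \<open>Summing out the lowest digit of \<open>s\<close> gives the factor
  \<open>1 + ?sgn\<close>, which vanishes when the lowest digits of \<open>x\<close> and
  \<open>y\<close> differ and is 2 otherwise; induction handles the remaining digits.\<close>

lemma hadamard_orthogonal:
  assumes "x < 2 ^ m" "y < 2 ^ m"
  shows "(\<Sum>s<2 ^ m. hadamard m s x * hadamard m s y) = (if x = y then 2 ^ m else 0)"
  using assms
proof (induction m arbitrary: x y)
  case 0
  then show ?case by simp
next
  case (Suc m)
  let ?sgn = "(if odd x = odd y then 1 else - 1) :: real"
  have "(\<Sum>s<2 ^ Suc m. hadamard (Suc m) s x * hadamard (Suc m) s y)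
      = (\<Sum>t<2 ^ m. (1 + ?sgn) * (hadamard m t (x div 2) * hadamard m t (y div 2)))"
    unfolding power_Suc sum_lessThan_double by (intro sum.cong refl) (auto simp: algebra_simps)
  also have "\<dots> = (1 + ?sgn) * (if x div 2 = y div 2 then 2 ^ m else 0)"
    using Suc.prems by (subst sum_distrib_left[symmetric], subst Suc.IH) auto
  also have "\<dots> = (if x = y then 2 ^ Suc m else 0)"
    by (auto elim!: evenE oddE)
  finally show ?case .
qed

text \<open>Independent centred summands have additive variances. The mean is part of the induction
  because it makes the cross term vanish.\<close>

lemma expectation_sum_sq_Pi_pmf:
  fixes G :: "'i \<Rightarrow> 'y \<Rightarrow> real"
  assumes "finite A" "\<And>i. i \<in> A \<Longrightarrow> finite (set_pmf (D i))"
    and "\<And>i. i \<in> A \<Longrightarrow> measure_pmf.expectation (D i) (G i) = 0"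
  shows "measure_pmf.expectation (Pi_pmf A dflt D) (\<lambda>y. \<Sum>i\<in>A. G i (y i)) = 0 \<and>
    measure_pmf.expectation (Pi_pmf A dflt D) (\<lambda>y. (\<Sum>i\<in>A. G i (y i))\<^sup>2)
      = (\<Sum>i\<in>A. measure_pmf.expectation (D i) (\<lambda>v. (G i v)\<^sup>2))"
  using assms
proof (induction A rule: finite_induct)
  case empty
  then show ?case by simp
next
  case (insert j A)
  let ?P = "Pi_pmf A dflt D" and ?S = "\<lambda>y. \<Sum>i\<in>A. G i (y i)"
  have finP: "finite (set_pmf ?P)"
    using insert by (auto simp: set_Pi_pmf intro!: finite_PiE_dflt)
  have finj: "finite (set_pmf (D j))" using insert by simp
  have IH: "measure_pmf.expectation ?P ?S = 0"
    "measure_pmf.expectation ?P (\<lambda>y. (?S y)\<^sup>2) = (\<Sum>i\<in>A. measure_pmf.expectation (D i) (\<lambda>v. (G i v)\<^sup>2))"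
    using insert by auto
  have Gj: "measure_pmf.expectation (D j) (G j) = 0" using insert by simp
  \<comment> \<open>Fubini for the new coordinate, for general \<open>F\<close> so that it serves
    both the mean and the square.\<close>
  have push: "measure_pmf.expectation (Pi_pmf (insert j A) dflt D) (\<lambda>y. F (\<Sum>i\<in>insert j A. G i (y i)))
      = measure_pmf.expectation (D j) (\<lambda>v. measure_pmf.expectation ?P (\<lambda>y. F (G j v + ?S y)))"
    for F :: "real \<Rightarrow> real"
  proof -
    have "measure_pmf.expectation (Pi_pmf (insert j A) dflt D) (\<lambda>y. F (\<Sum>i\<in>insert j A. G i (y i)))
        = measure_pmf.expectation (pair_pmf (D j) ?P) (\<lambda>z. F (G j (fst z) + ?S (snd z)))"
    proof -
      have "(\<Sum>i\<in>A. G i ((f(j := v)) i)) = ?S f" for f v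
        using insert by (intro sum.cong) auto
      then show ?thesis using insert by (simp add: Pi_pmf_insert case_prod_unfold)
    qed
    also have "\<dots> = measure_pmf.expectation (D j \<bind> (\<lambda>v. map_pmf (Pair v) ?P)) (\<lambda>z. F (G j (fst z) + ?S (snd z)))"
      by (simp add: pair_pmf_def map_pmf_def)
    also have "\<dots> = measure_pmf.expectation (D j) (\<lambda>v. measure_pmf.expectation ?P (\<lambda>y. F (G j v + ?S y)))"
      using finP finj
      by (subst pmf_expectation_bind[of "set_pmf (D j)"])
         (auto simp: integral_measure_pmf[of "set_pmf (D j)"])
    finally show ?thesis .
  qed
  have int: "integrable ?P f" "integrable (D j) g" for f :: "_ \<Rightarrow> real" and g :: "_ \<Rightarrow> real"
    using finP finj by (auto intro: integrable_measure_pmf_finite)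
  show ?case
    unfolding push[of "\<lambda>x. x"] push[of "\<lambda>x. x\<^sup>2"]
    using insert.hyps by (simp add: int power2_sum IH Gj)
qed

lemma expectation_noisy_bit:
  assumes "0 < e"
  shows "measure_pmf.expectation (noisy_bit e b) (\<lambda>t. if t then - 1 else 1 :: real)
    = (1 - 2 * flip_prob e) * (if b then - 1 else 1)"
proof -
  have "0 < flip_prob e" "flip_prob e < 1" using flip_prob_bounds[OF assms] by auto
  then show ?thesis by (simp add: noisy_bit_def)
qed

text \<open>The class contains the \<open>n div M\<close> numbers \<open>t * M + s + 1\<close>, and
  \<open>n div M >= 1\<close> makes this at least half of \<open>n / M\<close>. The shift by one
  reflects that users are counted from 1.\<close>

lemma card_residue_class:
  fixes n M s :: nat
  assumes "s < M" "M \<le> n"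
  shows "real n / (2 * real M) \<le> real (card {i\<in>{1..n}. (i - 1) mod M = s})"
proof -
  have "(\<lambda>t. t * M + s + 1) ` {..<n div M} \<subseteq> {i\<in>{1..n}. (i - 1) mod M = s}"
  proof safe
    fix t assume t: "t < n div M"
    then have "(t + 1) * M \<le> n div M * M" by (intro mult_right_mono) auto
    also have "\<dots> \<le> n" by simp
    finally show "t * M + s + 1 \<in> {1..n}" using assms by simp
    show "(t * M + s + 1 - 1) mod M = s" using assms by simp
  qed
  then have "card ((\<lambda>t. t * M + s + 1) ` {..<n div M}) \<le> card {i\<in>{1..n}. (i - 1) mod M = s}"
    by (intro card_mono) auto
  moreover have "card ((\<lambda>t. t * M + s + 1) ` {..<n div M}) = n div M"
    using assms by (subst card_image) (auto simp: inj_on_def)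
  ultimately have c: "n div M \<le> card {i\<in>{1..n}. (i - 1) mod M = s}" by simp
  have "n = n div M * M + n mod M" by simp
  also have "\<dots> \<le> n div M * M + M" using assms by (intro add_left_mono) (simp add: less_imp_le)
  also have "\<dots> \<le> n div M * M + n div M * M"
    using assms by (intro add_left_mono) (simp add: div_greater_zero_iff Suc_leI)
  finally have "n \<le> 2 * M * (n div M)" by (simp add: algebra_simps)
  then have "n \<le> 2 * M * card {i\<in>{1..n}. (i - 1) mod M = s}"
    using mult_left_mono[OF c, of "2 * M"] by linarith
  then have "real n \<le> 2 * real M * real (card {i\<in>{1..n}. (i - 1) mod M = s})"
    by (metis of_nat_le_iff of_nat_mult of_nat_numeral)
  then show ?thesis using assms by (simp add: divide_le_eq mult_ac)
qed

lemma inverse_hadamard_transform: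
  assumes p: "p \<in> prob_simplex k" and k: "k < 2 ^ m" and a: "a \<in> {1..k}"
  shows "(\<Sum>s<2 ^ m. hadamard m s a * (\<Sum>x=1..k. pmf p x * hadamard m s x)) = 2 ^ m * pmf p a"
proof -
  have "(\<Sum>s<2 ^ m. hadamard m s a * (\<Sum>x=1..k. pmf p x * hadamard m s x))
      = (\<Sum>s<2 ^ m. \<Sum>x=1..k. pmf p x * (hadamard m s a * hadamard m s x))"
    by (simp add: sum_distrib_left mult_ac)
  also have "\<dots> = (\<Sum>x=1..k. pmf p x * (\<Sum>s<2 ^ m. hadamard m s a * hadamard m s x))"
    by (subst sum.swap) (simp add: sum_distrib_left)
  also have "\<dots> = (\<Sum>x=1..k. if a = x then 2 ^ m * pmf p a else 0)"
    using k a by (intro sum.cong refl) (auto simp: hadamard_orthogonal)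
  also have "\<dots> = 2 ^ m * pmf p a" using a by simp
  finally show ?thesis .
qed

lemma expectation_simplex_bind:
  assumes p: "p \<in> prob_simplex k" and fin: "\<And>x. x \<in> {1..k} \<Longrightarrow> finite (set_pmf (Q x))"
  shows "measure_pmf.expectation (p \<bind> Q) g = (\<Sum>x=1..k. pmf p x * measure_pmf.expectation (Q x) (g :: _ \<Rightarrow> real))"
proof (subst pmf_expectation_bind[of "{1..k}"])
  show "finite {1..k}" "set_pmf p \<subseteq> {1..k}" using p by (auto simp: prob_simplex_def)
qed (use fin in auto)

text \<open>User \<open>i\<close> reports on row \<open>(i - 1) mod 2 ^ m\<close>. The rescaled
  signs of a row estimate one Hadamard coefficient of \<open>p\<close> without bias, and the inverse
  transform turns them into a weighted sum of independent signs for each mass; its variance is at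
  most the sum of squared weights.\<close>

lemma hadamard_estimator_risk:
  fixes Q :: "nat \<Rightarrow> nat \<Rightarrow> 'y pmf" and dec :: "'y \<Rightarrow> bool"
  assumes e: "0 < e" and k: "k < 2 ^ m" and n: "2 ^ m \<le> n"
    and fin: "\<And>i x. i \<in> {1..n} \<Longrightarrow> x \<in> {1..k} \<Longrightarrow> finite (set_pmf (Q i x))"
    and dec: "\<And>i x. i \<in> {1..n} \<Longrightarrow> x \<in> {1..k} \<Longrightarrow>
       map_pmf dec (Q i x) = noisy_bit e (hadamard m ((i - 1) mod 2 ^ m) x < 0)"
  shows "\<exists>est. worst_case_risk n k Q est \<le> ennreal (2 * real k / (real n * (1 - 2 * flip_prob e)\<^sup>2))"
proof -
  define M :: nat where "M = 2 ^ m"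
  define r where "r i = (i - 1) mod M" for i :: nat
  define cnt where "cnt s = real (card {i\<in>{1..n}. r i = s})" for s
  define c where "c = 1 - 2 * flip_prob e"
  \<comment> \<open>Division by \<open>real M\<close> normalizes the inverse transform, by
    \<open>cnt (r i)\<close> averages over the users of a row, and by \<open>c\<close> undoes the
    shrinkage caused by random flips.\<close>
  define w where "w i a = hadamard m (r i) a / (real M * cnt (r i) * c)" for i a
  define sg :: "'y \<Rightarrow> real" where "sg y = (if dec y then - 1 else 1)" for y
  define est where "est y a = (\<Sum>i=1..n. w i a * sg (y i))" for y :: "nat \<Rightarrow> 'y" and a
  have c: "c > 0" using flip_prob_bounds[OF e] by (simp add: c_def)
  have M: "M > 0" "M \<le> n" using n by (auto simp: M_def)
  have n0: "n > 0" using M by linarith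
  have cnt: "real n / (2 * real M) \<le> cnt s" if "s < M" for s
    using card_residue_class[of s M n] that M by (simp add: cnt_def r_def)
  have cnt0: "cnt s > 0" if "s < M" for s
    using cnt[OF that] M n0 by (auto intro: less_le_trans[rotated])
  have r: "r i < M" for i using M by (simp add: r_def)
  have groups: "(\<Sum>i=1..n. F (r i)) = (\<Sum>s<M. cnt s * F s)" for F :: "nat \<Rightarrow> real"
  proof -
    have "(\<Sum>i=1..n. F (r i)) = (\<Sum>s<M. \<Sum>i | i \<in> {1..n} \<and> r i = s. F (r i))"
      using r by (subst sum.group) auto
    then show ?thesis by (simp add: cnt_def)
  qed
  have main: "(\<integral>\<^sup>+ y. ennreal (\<Sum>a=1..k. (est y a - pmf p a)\<^sup>2) \<partial>measure_pmf (observation_law n Q p))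
      \<le> ennreal (2 * real k / (real n * c\<^sup>2))" if p: "p \<in> prob_simplex k" for p
  proof -
    let ?D = "\<lambda>i. p \<bind> Q i" and ?P = "observation_law n Q p"
    have finD: "finite (set_pmf (?D i))" if "i \<in> {1..n}" for i
      using p that fin by (auto simp: prob_simplex_def intro!: finite_UN_I[OF finite_subset[of _ "{1..k}"]])
    have finP: "finite (set_pmf ?P)"
      using finD by (auto simp: observation_law_def set_Pi_pmf intro!: finite_PiE_dflt simp del: set_bind_pmf)
    have int: "integrable ?P F" for F :: "_ \<Rightarrow> real"
      using finP by (rule integrable_measure_pmf_finite)
    define \<mu> where "\<mu> i = measure_pmf.expectation (?D i) sg" for i
    have mu: "\<mu> i = c * (\<Sum>x=1..k. pmf p x * hadamard m (r i) x)" if i: "i \<in> {1..n}" for i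
    proof -
      have "measure_pmf.expectation (Q i x) sg = c * hadamard m (r i) x" if x: "x \<in> {1..k}" for x
      proof -
        have "measure_pmf.expectation (Q i x) sg
            = measure_pmf.expectation (map_pmf dec (Q i x)) (\<lambda>t. if t then - 1 else 1 :: real)"
          by (simp add: sg_def[abs_def])
        also have "\<dots> = c * hadamard m (r i) x"
          unfolding dec[OF i x] expectation_noisy_bit[OF e] c_def
          using hadamard_cases[of m "r i" x] by (auto simp: r_def M_def)
        finally show ?thesis .
      qed
      moreover have "\<mu> i = (\<Sum>x=1..k. pmf p x * measure_pmf.expectation (Q i x) sg)"
        unfolding \<mu>_def using p fin i by (intro expectation_simplex_bind) auto
      ultimately show ?thesis by (simp add: sum_distrib_left mult_ac)
    qed
    have unbiased: "(\<Sum>i=1..n. w i a * \<mu> i) = pmf p a" if a: "a \<in> {1..k}" for a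
    proof -
      let ?F = "\<lambda>s. hadamard m s a / (real M * cnt s) * (\<Sum>x=1..k. pmf p x * hadamard m s x)"
      have "(\<Sum>i=1..n. w i a * \<mu> i) = (\<Sum>i=1..n. ?F (r i))"
        using c by (intro sum.cong refl) (simp add: mu w_def)
      also have "\<dots> = (\<Sum>s<M. hadamard m s a * (\<Sum>x=1..k. pmf p x * hadamard m s x)) / real M"
        unfolding groups[of ?F] sum_divide_distrib using cnt0 by (intro sum.cong refl) (force simp: field_simps)
      also have "\<dots> = pmf p a"
        using inverse_hadamard_transform[OF p k a] M by (simp add: M_def)
      finally show ?thesis .
    qed
    \<comment> \<open>Each of the \<open>M\<close> rows has at least \<open>n / (2 * M)\<close>
      users and so contributes at most \<open>2 / (M * n * c\<^sup>2)\<close>.\<close>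
    have wsq: "(\<Sum>i=1..n. (w i a)\<^sup>2) \<le> 2 / (real n * c\<^sup>2)" for a
    proof -
      let ?F = "\<lambda>s. 1 / (real M * cnt s * c)\<^sup>2"
      have "(\<Sum>i=1..n. (w i a)\<^sup>2) = (\<Sum>i=1..n. ?F (r i))"
        by (simp add: w_def power_divide)
      also have "\<dots> = (\<Sum>s<M. 1 / ((real M)\<^sup>2 * c\<^sup>2 * cnt s))"
        unfolding groups[of ?F] using cnt0 by (intro sum.cong refl) (force simp: power2_eq_square field_simps)
      also have "\<dots> \<le> (\<Sum>s<M. 1 / ((real M)\<^sup>2 * c\<^sup>2 * (real n / (2 * real M))))"
        using c M n0 cnt cnt0 by (intro sum_mono divide_left_mono mult_left_mono mult_pos_pos) auto
      also have "\<dots> = 2 / (real n * c\<^sup>2)"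
        using c M n0 by (simp add: power2_eq_square field_simps)
      finally show ?thesis .
    qed
    have var: "measure_pmf.expectation ?P (\<lambda>y. (est y a - pmf p a)\<^sup>2) \<le> 2 / (real n * c\<^sup>2)"
      if a: "a \<in> {1..k}" for a
    proof -
      let ?G = "\<lambda>i v. w i a * (sg v - \<mu> i)"
      have intD: "integrable (?D i) F" if "i \<in> {1..n}" for i and F :: "_ \<Rightarrow> real"
        using finD[OF that] by (rule integrable_measure_pmf_finite)
      have zero: "measure_pmf.expectation (?D i) (?G i) = 0" if "i \<in> {1..n}" for i
        using intD[OF that] by (simp add: \<mu>_def)
      have "est y a - pmf p a = (\<Sum>i=1..n. ?G i (y i))" for y
        using unbiased[OF a] by (simp add: est_def sum_subtractf right_diff_distrib)
      then have "measure_pmf.expectation ?P (\<lambda>y. (est y a - pmf p a)\<^sup>2)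
          = measure_pmf.expectation ?P (\<lambda>y. (\<Sum>i\<in>{1..n}. ?G i (y i))\<^sup>2)" by simp
      also have "\<dots> = (\<Sum>i=1..n. measure_pmf.expectation (?D i) (\<lambda>v. (?G i v)\<^sup>2))"
        unfolding observation_law_def using finD zero by (intro expectation_sum_sq_Pi_pmf[THEN conjunct2]) auto
      also have "\<dots> \<le> (\<Sum>i=1..n. (w i a)\<^sup>2)"
      proof (rule sum_mono)
        fix i assume i: "i \<in> {1..n}"
        have "measure_pmf.expectation (?D i) (\<lambda>v. (?G i v)\<^sup>2)
            = (w i a)\<^sup>2 * measure_pmf.expectation (?D i) (\<lambda>v. (sg v - \<mu> i)\<^sup>2)"
          by (simp add: power_mult_distrib)
        \<comment> \<open>A sign has square 1, so its variance is
          \<open>1 - (\<mu> i)\<^sup>2\<close>.\<close>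
        also have "measure_pmf.expectation (?D i) (\<lambda>v. (sg v - \<mu> i)\<^sup>2)
            = measure_pmf.expectation (?D i) (\<lambda>v. 1 + (\<mu> i)\<^sup>2 - 2 * \<mu> i * sg v)"
          by (rule arg_cong[where f = "measure_pmf.expectation (?D i)"])
             (auto simp: sg_def power2_eq_square algebra_simps)
        also have "\<dots> = 1 - (\<mu> i)\<^sup>2"
          using intD[OF i] by (simp add: \<mu>_def[symmetric] power2_eq_square)
        also have "(w i a)\<^sup>2 * (1 - (\<mu> i)\<^sup>2) \<le> (w i a)\<^sup>2 * 1"
          by (intro mult_left_mono) auto
        finally show "measure_pmf.expectation (?D i) (\<lambda>v. (?G i v)\<^sup>2) \<le> (w i a)\<^sup>2" by simp
      qed
      finally show ?thesis using wsq[of a] by linarith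
    qed
    have "(\<integral>\<^sup>+ y. ennreal (\<Sum>a=1..k. (est y a - pmf p a)\<^sup>2) \<partial>?P)
        = ennreal (measure_pmf.expectation ?P (\<lambda>y. \<Sum>a=1..k. (est y a - pmf p a)\<^sup>2))"
      by (intro nn_integral_eq_integral int AE_I2 sum_nonneg zero_le_power2)
    also have "measure_pmf.expectation ?P (\<lambda>y. \<Sum>a=1..k. (est y a - pmf p a)\<^sup>2)
        = (\<Sum>a=1..k. measure_pmf.expectation ?P (\<lambda>y. (est y a - pmf p a)\<^sup>2))"
      by (simp add: int)
    also have "\<dots> \<le> (\<Sum>a=1..k. 2 / (real n * c\<^sup>2))"
      by (intro sum_mono var)
    also have "\<dots> = 2 * real k / (real n * c\<^sup>2)" by simp
    finally show ?thesis by (simp add: ennreal_leI)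
  qed
  show ?thesis
    unfolding worst_case_risk_def c_def[symmetric]
    by (intro exI[of _ est] SUP_least main)
qed

section \<open>Comparison with the rate \<open>k / (n * e\<^sup>2)\<close>\<close>

lemma zero_estimator_risk: "worst_case_risk n k Q (\<lambda>_ _. 0) \<le> 1"
proof -
  have "(\<integral>\<^sup>+ y. ennreal (\<Sum>a=1..k. (0 - pmf p a)\<^sup>2) \<partial>measure_pmf (observation_law n Q p)) \<le> 1"
    if "p \<in> prob_simplex k" for p
  proof -
    have "(\<Sum>a=1..k. (pmf p a)\<^sup>2) \<le> (\<Sum>a=1..k. pmf p a)"
      by (intro sum_mono) (simp add: power2_eq_square mult_left_le pmf_le_1)
    also have "\<dots> = 1" using that by (intro sum_pmf_eq_1) (auto simp: prob_simplex_def)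
    finally show ?thesis by (simp add: measure_pmf.emeasure_space_1)
  qed
  then show ?thesis unfolding worst_case_risk_def by (intro SUP_least)
qed

text \<open>The order of the Hadamard matrix: above \<open>k\<close>, so that the symbols 1 to
  \<open>k\<close> index distinct columns, and at most \<open>2 * k\<close>, so that
  \<open>n >= 2 * k\<close> users cover every row.\<close>

lemma exists_power2_between:
  assumes "(k::nat) \<ge> 1"
  shows "\<exists>m. k < 2 ^ m \<and> 2 ^ m \<le> 2 * k"
  using assms
proof (induction k rule: dec_induct)
  case base
  show ?case by (intro exI[of _ 1]) simp
next
  case (step k)
  then obtain m where m: "k < 2 ^ m" "2 ^ m \<le> 2 * k" by blast
  show ?case
  proof (cases "Suc k = 2 ^ m")
    case True
    then show ?thesis by (intro exI[of _ "Suc m"]) simp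
  next
    case False
    then show ?thesis using m by (intro exI[of _ m]) simp
  qed
qed

text \<open>The first summand covers \<open>n < 2k\<close>, where the zero estimator suffices, the second the Hadamard
  estimator.\<close>

definition risk_const :: "real \<Rightarrow> real" where
  "risk_const B = 2 * B\<^sup>2 + 2 * (exp B + 1)\<^sup>2"

lemma risk_const_trivial:
  assumes "0 < e" "e \<le> B" "n < 2 * k" "n \<ge> 1"
  shows "1 \<le> risk_const B * (real k / (real n * e\<^sup>2))"
proof -
  have "real n * e\<^sup>2 \<le> 2 * real k * B\<^sup>2"
    using assms by (intro mult_mono power_mono) auto
  also have "\<dots> \<le> risk_const B * real k" by (simp add: risk_const_def algebra_simps)
  finally show ?thesis using assms by (simp add: le_divide_eq)
qed

text \<open>The right side is \<open>(exp e - 1) / (exp e + 1)\<close>, with numerator at least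
  \<open>e\<close> and denominator bounded on the range up to \<open>B\<close>.\<close>

lemma one_minus_two_flip_prob:
  assumes "0 < e" "e \<le> B"
  shows "e / (exp B + 1) \<le> 1 - 2 * flip_prob e"
proof -
  have p: "exp e + 1 > 0" "exp B + 1 > 0" by (simp_all add: add_pos_pos)
  then have "1 - 2 * flip_prob e = (exp e - 1) / (exp e + 1)"
    by (simp add: flip_prob_def field_simps)
  moreover have "e \<le> exp e - 1" using exp_ge_add_one_self[of e] by linarith
  then have "e / (exp B + 1) \<le> (exp e - 1) / (exp e + 1)"
    using assms p by (intro frac_le) auto
  ultimately show ?thesis by simp
qed

lemma risk_const_hadamard:
  assumes "0 < e" "e \<le> B" "n \<ge> 1"
  shows "2 * real k / (real n * (1 - 2 * flip_prob e)\<^sup>2) \<le> risk_const B * (real k / (real n * e\<^sup>2))"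
proof -
  have p: "exp B + 1 > 0" by (simp add: add_pos_pos)
  have "2 * real k / (real n * (1 - 2 * flip_prob e)\<^sup>2) \<le> 2 * real k / (real n * (e / (exp B + 1))\<^sup>2)"
    using assms p one_minus_two_flip_prob[OF assms(1,2)] flip_prob_bounds[OF assms(1)]
    by (intro divide_left_mono mult_left_mono power_mono mult_pos_pos zero_less_power) auto
  also have "\<dots> = 2 * (exp B + 1)\<^sup>2 * (real k / (real n * e\<^sup>2))"
    using assms p by (simp add: power_divide)
  also have "\<dots> \<le> risk_const B * (real k / (real n * e\<^sup>2))"
    by (intro mult_right_mono) (auto simp: risk_const_def)
  finally show ?thesis .
qed

text \<open>Only the law of the decoded bit matters, so one bound serves plain randomized response
  and every analyst's view.\<close>

lemma exists_estimator:
  fixes Q :: "nat \<Rightarrow> nat \<Rightarrow> 'y pmf" and dec :: "'y \<Rightarrow> bool"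
  assumes "0 < e" "e \<le> B" "n \<ge> 1" "k < 2 ^ m" "2 ^ m \<le> 2 * k"
    and "\<And>i x. i \<in> {1..n} \<Longrightarrow> x \<in> {1..k} \<Longrightarrow> finite (set_pmf (Q i x))"
    and "\<And>i x. i \<in> {1..n} \<Longrightarrow> x \<in> {1..k} \<Longrightarrow>
       map_pmf dec (Q i x) = noisy_bit e (hadamard m ((i - 1) mod 2 ^ m) x < 0)"
  shows "\<exists>est. worst_case_risk n k Q est \<le> ennreal (risk_const B * (real k / (real n * e\<^sup>2)))"
proof (cases "n < 2 * k")
  case True
  have "worst_case_risk n k Q (\<lambda>_ _. 0) \<le> ennreal 1" using zero_estimator_risk by simp
  also have "\<dots> \<le> ennreal (risk_const B * (real k / (real n * e\<^sup>2)))"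
    using True assms by (intro ennreal_leI risk_const_trivial) auto
  finally show ?thesis by blast
next
  case False
  then obtain est where "worst_case_risk n k Q est \<le> ennreal (2 * real k / (real n * (1 - 2 * flip_prob e)\<^sup>2))"
    using hadamard_estimator_risk[of e k m n Q dec] assms by auto
  also have "\<dots> \<le> ennreal (risk_const B * (real k / (real n * e\<^sup>2)))"
    using assms by (intro ennreal_leI risk_const_hadamard) auto
  finally show ?thesis by blast
qed

lemma minimax_risk_upper:
  assumes e: "0 < e" "e \<le> B" and nk: "n \<ge> 1" "k \<ge> 1"
  shows "minimax_risk e n k \<le> ennreal (risk_const B * (real k / (real n * e\<^sup>2)))"
proof -
  obtain m where m: "k < 2 ^ m" "2 ^ m \<le> 2 * k" using exists_power2_between nk by blast
  \<comment> \<open>Unmasked randomized response on Hadamard bits, with outputs coded in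
    \<open>nat\<close> to fit \<open>minimax_risk\<close>.\<close>
  define Q :: "nat \<Rightarrow> nat \<Rightarrow> nat pmf" where
    "Q i x = noisy_bit e (hadamard m ((i - 1) mod 2 ^ m) x < 0) \<bind> (\<lambda>t. return_pmf (of_bool t))" for i x
  have ldp: "ldp e k (Q i)" for i
    unfolding Q_def using e by (intro ldp_noisy_bit_bind) auto
  have "\<exists>est. worst_case_risk n k Q est \<le> ennreal (risk_const B * (real k / (real n * e\<^sup>2)))"
  proof (rule exists_estimator[OF e nk(1) m])
    show "finite (set_pmf (Q i x))" for i x by (simp add: Q_def)
    show "map_pmf (\<lambda>y. y = 1) (Q i x) = noisy_bit e (hadamard m ((i - 1) mod 2 ^ m) x < 0)" for i x
      
    proof -
      have "((of_bool t :: nat) = 1) = t" for t by simp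
      then show ?thesis
        by (simp only: Q_def map_bind_pmf map_return_pmf bind_return_pmf')
    qed
  qed
  then obtain est where est: "worst_case_risk n k Q est \<le> ennreal (risk_const B * (real k / (real n * e\<^sup>2)))"
    by blast
  have "minimax_risk e n k \<le> worst_case_risk n k Q est"
    unfolding minimax_risk_def using ldp by (intro INF_lower2[of Q] INF_lower) auto
  with est show ?thesis by simp
qed

text \<open>All users share one key law; only the Hadamard row depends on the user. Analyst
  \<open>j\<close> lacks exactly the bits 1 to \<open>j\<close>, whose parity is true with
  probability \<open>flip_prob (\<epsilon> j)\<close>.\<close>

lemma multi_level_mechanism:
  assumes d: "strict_antimono_on {1..d} \<epsilon>" and e: "\<forall>j\<in>{1..d}. 0 < \<epsilon> j \<and> \<epsilon> j \<le> B"
    and nk: "n \<ge> 1" "k \<ge> 1"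
  shows "\<exists>(K :: nat \<Rightarrow> nat pmf) (f :: nat \<Rightarrow> nat \<Rightarrow> nat \<Rightarrow> nat) (L :: nat \<Rightarrow> nat \<Rightarrow> nat \<Rightarrow> nat).
        (\<forall>i\<in>{1..n}. entropy_bits (K i) = (\<Sum>j=1..d. H2 (key_bit_prob \<epsilon> j))) \<and>
        (\<forall>j\<in>{1..d}.
           (\<forall>i\<in>{1..n}. ldp (\<epsilon> j) k (analyst_view (K i) (f i) (L j i))) \<and>
           (\<exists>est. worst_case_risk n k (\<lambda>i. analyst_view (K i) (f i) (L j i)) est
                    \<le> ennreal (risk_const B * (real k / (real n * (\<epsilon> j)\<^sup>2)))))"
proof -
  obtain m where m: "k < 2 ^ m" "2 ^ m \<le> 2 * k" using exists_power2_between nk by blast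
  define qs where "qs = map (key_bit_prob \<epsilon>) [1..<Suc d]"
  \<comment> \<open>Bit lists are coded injectively in \<open>nat\<close>, which preserves the
    entropy.\<close>
  define K where "K = map_pmf to_nat (bits_pmf qs)"
  define h where "h i x \<longleftrightarrow> hadamard m ((i - 1) mod 2 ^ m) x < 0" for i x
  have "entropy_bits K = (\<Sum>q\<leftarrow>qs. H2 q)"
    unfolding K_def using key_bit_prob_bounds[OF d] e
    by (subst entropy_bits_map_inj)
       (auto simp: finite_set_bits_pmf qs_def simp del: upt_Suc map_map intro!: entropy_bits_bits_pmf)
  also have "\<dots> = (\<Sum>j=1..d. H2 (key_bit_prob \<epsilon> j))"
    by (simp add: qs_def o_def interv_sum_list_conv_sum_set_nat atLeastLessThanSuc_atLeastAtMost del: upt_Suc)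
  finally have ent: "entropy_bits K = (\<Sum>j=1..d. H2 (key_bit_prob \<epsilon> j))" .
  have view: "ldp (\<epsilon> j) k (analyst_view K (masked_bit (h i)) (key_suffix j))"
    "map_pmf unmask (analyst_view K (masked_bit (h i)) (key_suffix j) x) = noisy_bit (\<epsilon> j) (h i x)"
    if j: "j \<in> {1..d}" for i j x
  proof -
    define rs where "rs = map (key_bit_prob \<epsilon>) [Suc j..<Suc d]"
    have qs: "qs = map (key_bit_prob \<epsilon>) [1..<Suc j] @ rs"
      using j upt_add_eq_append[of 1 "Suc j" "d - j"] by (simp add: qs_def rs_def del: upt_Suc)
    have view: "analyst_view K (masked_bit (h i)) (key_suffix j) = (\<lambda>x. noisy_bit (\<epsilon> j) (h i x) \<bind>
        (\<lambda>t. map_pmf (\<lambda>w. (of_bool (t \<noteq> parity w), to_nat w)) (bits_pmf rs)))"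
      unfolding K_def qs using j e
      by (intro ext analyst_view_masked_bit map_parity_key_bits[OF d]) (auto simp del: upt_Suc)
    show "ldp (\<epsilon> j) k (analyst_view K (masked_bit (h i)) (key_suffix j))"
      unfolding view using e j by (intro ldp_noisy_bit_bind) (auto simp: finite_set_bits_pmf)
    show "map_pmf unmask (analyst_view K (masked_bit (h i)) (key_suffix j) x) = noisy_bit (\<epsilon> j) (h i x)"
      unfolding view by (rule map_unmask_view)
  qed
  have "\<exists>est. worst_case_risk n k (\<lambda>i. analyst_view K (masked_bit (h i)) (key_suffix j)) est
      \<le> ennreal (risk_const B * (real k / (real n * (\<epsilon> j)\<^sup>2)))" if j: "j \<in> {1..d}" for j
  proof (rule exists_estimator[where m = m and dec = unmask])
    show "finite (set_pmf (analyst_view K (masked_bit (h i)) (key_suffix j) x))" for i x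
      by (simp add: analyst_view_def K_def finite_set_bits_pmf)
  qed (use e j nk m view(2)[OF j] in \<open>auto simp: h_def\<close>)
  with ent view(1) show ?thesis
    by (intro exI[of _ "\<lambda>_. K"] exI[of _ "\<lambda>i. masked_bit (h i)"] exI[of _ "\<lambda>j i. key_suffix j"]) auto
qed

section \<open>The lower bound\<close>

text \<open>Le Cam's two-point argument with the Hellinger affinity \<open>A\<close>: writing
  \<open>\<theta> - \<theta>'\<close> as \<open>(T y - \<theta>') - (T y - \<theta>)\<close> splits
  \<open>A * (\<theta> - \<theta>')\<close> into two sums, each bounded by the Cauchy-Schwarz
  inequality.\<close>

lemma two_point_bound:
  fixes P P' :: "'y pmf" and T :: "'y \<Rightarrow> real"
  assumes S: "finite S" "set_pmf P \<subseteq> S" "set_pmf P' \<subseteq> S"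
  defines "A \<equiv> \<Sum>y\<in>S. sqrt (pmf P y) * sqrt (pmf P' y)"
  shows "(A * (\<theta> - \<theta>'))\<^sup>2 \<le> 2 * ((\<Sum>y\<in>S. pmf P y * (T y - \<theta>)\<^sup>2) + (\<Sum>y\<in>S. pmf P' y * (T y - \<theta>')\<^sup>2))"
proof -
  let ?u = "\<Sum>y\<in>S. (sqrt (pmf P y) * (T y - \<theta>')) * sqrt (pmf P' y)"
  let ?v = "\<Sum>y\<in>S. (sqrt (pmf P y) * (T y - \<theta>)) * sqrt (pmf P' y)"
  have "?u = (\<Sum>y\<in>S. (sqrt (pmf P' y) * (T y - \<theta>')) * sqrt (pmf P y))"
    by (simp add: mult_ac)
  then have "?u\<^sup>2 \<le> (\<Sum>y\<in>S. (sqrt (pmf P' y) * (T y - \<theta>'))\<^sup>2) * (\<Sum>y\<in>S. (sqrt (pmf P y))\<^sup>2)"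
    by (simp only: Cauchy_Schwarz_ineq_sum)
  also have "\<dots> = (\<Sum>y\<in>S. pmf P' y * (T y - \<theta>')\<^sup>2)"
    using S by (simp add: power_mult_distrib sum_pmf_eq_1)
  finally have u: "?u\<^sup>2 \<le> (\<Sum>y\<in>S. pmf P' y * (T y - \<theta>')\<^sup>2)" .
  have "?v\<^sup>2 \<le> (\<Sum>y\<in>S. (sqrt (pmf P y) * (T y - \<theta>))\<^sup>2) * (\<Sum>y\<in>S. (sqrt (pmf P' y))\<^sup>2)"
    by (rule Cauchy_Schwarz_ineq_sum)
  also have "\<dots> = (\<Sum>y\<in>S. pmf P y * (T y - \<theta>)\<^sup>2)"
    using S by (simp add: power_mult_distrib sum_pmf_eq_1)
  finally have v: "?v\<^sup>2 \<le> (\<Sum>y\<in>S. pmf P y * (T y - \<theta>)\<^sup>2)" .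
  have "A * (\<theta> - \<theta>') = ?u - ?v"
    unfolding A_def sum_distrib_right sum_subtractf[symmetric]
    by (intro sum.cong refl) (simp add: algebra_simps)
  moreover have "(?u - ?v)\<^sup>2 \<le> 2 * (?v\<^sup>2 + ?u\<^sup>2)"
    using zero_le_power2[of "?u + ?v"] by (simp add: power2_sum power2_diff algebra_simps)
  ultimately show ?thesis using u v by (auto intro: order_trans)
qed

section \<open>Hellinger affinity of nearby laws\<close>

lemma geometric_mean_lower:
  fixes a b \<eta> :: real
  assumes "0 \<le> a" "0 \<le> b" "\<bar>a - b\<bar> \<le> \<eta> * a" "\<bar>a - b\<bar> \<le> \<eta> * b"
  shows "(a + b) / 2 * (1 - \<eta>\<^sup>2 / 4) \<le> sqrt a * sqrt b"
proof (cases "a + b = 0")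
  case True
  then have "a = 0" "b = 0" using assms by auto
  then show ?thesis by simp
next
  case False
  then have ab: "a + b > 0" using assms by linarith
  \<comment> \<open>The arithmetic mean exceeds the geometric one by half of
    \<open>(sqrt a - sqrt b)\<^sup>2\<close>, which is at most
    \<open>(a - b)\<^sup>2 / (a + b)\<close>.\<close>
  have "(sqrt a - sqrt b)\<^sup>2 * (a + b) \<le> (sqrt a - sqrt b)\<^sup>2 * (sqrt a + sqrt b)\<^sup>2"
    using assms by (intro mult_left_mono) (auto simp: power2_sum)
  also have "\<dots> = (a - b)\<^sup>2"
    using assms by (simp add: square_diff_square_factored flip: power_mult_distrib)
      (simp add: algebra_simps)
  also have "\<dots> = \<bar>a - b\<bar>\<^sup>2" by simp
  also have "\<dots> \<le> (\<eta> * (a + b) / 2)\<^sup>2"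
    using assms by (intro power_mono) (auto simp: algebra_simps)
  also have "\<dots> = (\<eta>\<^sup>2 / 4 * (a + b)) * (a + b)"
    by (simp add: power2_eq_square)
  finally have "(sqrt a - sqrt b)\<^sup>2 \<le> \<eta>\<^sup>2 / 4 * (a + b)"
    using ab by simp
  then have "((a + b) - \<eta>\<^sup>2 / 4 * (a + b)) / 2 \<le> ((a + b) - (sqrt a - sqrt b)\<^sup>2) / 2"
    by (intro divide_right_mono diff_left_mono) auto
  also have "\<dots> = sqrt a * sqrt b"
    using assms by (simp add: power2_diff)
  finally show ?thesis by (simp add: field_simps)
qed

lemma affinity_lower:
  fixes P P' :: "'y pmf"
  assumes S: "finite S" "set_pmf P \<subseteq> S" "set_pmf P' \<subseteq> S"
    and "\<And>y. \<bar>pmf P y - pmf P' y\<bar> \<le> \<eta> * pmf P y" "\<And>y. \<bar>pmf P y - pmf P' y\<bar> \<le> \<eta> * pmf P' y"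
  shows "1 - \<eta>\<^sup>2 / 4 \<le> (\<Sum>y\<in>S. sqrt (pmf P y) * sqrt (pmf P' y))"
proof -
  have "1 - \<eta>\<^sup>2 / 4 = (\<Sum>y\<in>S. (pmf P y + pmf P' y) / 2 * (1 - \<eta>\<^sup>2 / 4))"
    using S by (simp add: sum_pmf_eq_1 sum.distrib flip: sum_distrib_right sum_divide_distrib)
  also have "\<dots> \<le> (\<Sum>y\<in>S. sqrt (pmf P y) * sqrt (pmf P' y))"
    using assms by (intro sum_mono geometric_mean_lower) auto
  finally show ?thesis .
qed

lemma real_sqrt_prod: "sqrt (\<Prod>x\<in>A. f x) = (\<Prod>x\<in>A. sqrt (f x))"
  by (induction A rule: infinite_finite_induct) (auto simp: real_sqrt_mult)

text \<open>The affinity of product laws is the product of the affinities, and Bernoulli's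
  inequality bounds it below by \<open>1 - card A * \<eta>\<^sup>2 / 4\<close>.\<close>

lemma affinity_Pi_pmf_lower:
  fixes D D' :: "'i \<Rightarrow> 'y pmf"
  assumes A: "finite A" and S: "\<And>i. i \<in> A \<Longrightarrow> finite (S i)"
    "\<And>i. i \<in> A \<Longrightarrow> set_pmf (D i) \<subseteq> S i" "\<And>i. i \<in> A \<Longrightarrow> set_pmf (D' i) \<subseteq> S i"
    and close: "\<And>i y. i \<in> A \<Longrightarrow> \<bar>pmf (D i) y - pmf (D' i) y\<bar> \<le> \<eta> * pmf (D i) y"
      "\<And>i y. i \<in> A \<Longrightarrow> \<bar>pmf (D i) y - pmf (D' i) y\<bar> \<le> \<eta> * pmf (D' i) y"
    and \<eta>: "real (card A) * \<eta>\<^sup>2 \<le> 2"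
  shows "1 / 2 \<le> (\<Sum>y\<in>PiE A S. sqrt (pmf (Pi_pmf A undefined D) y) * sqrt (pmf (Pi_pmf A undefined D') y))"
proof (cases "A = {}")
  case True
  then show ?thesis by simp
next
  case False
  then have "1 \<le> card A" using A by (simp add: card_gt_0_iff Suc_leI)
  then have "\<eta>\<^sup>2 \<le> real (card A) * \<eta>\<^sup>2" by (simp add: mult_le_cancel_right1)
  \<comment> \<open>This keeps \<open>1 - \<eta>\<^sup>2 / 4\<close> nonnegative, as monotonicity of
    the product demands.\<close>
  then have \<eta>2: "\<eta>\<^sup>2 \<le> 2" using \<eta> by linarith
  have "1 / 2 \<le> 1 + real (card A) * (- \<eta>\<^sup>2 / 4)" using \<eta> by simp
  also have "\<dots> \<le> (1 + (- \<eta>\<^sup>2 / 4)) ^ card A"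
    using \<eta>2 by (intro Bernoulli_inequality) simp
  also have "\<dots> = (\<Prod>i\<in>A. 1 - \<eta>\<^sup>2 / 4)" by simp
  also have "\<dots> \<le> (\<Prod>i\<in>A. \<Sum>y\<in>S i. sqrt (pmf (D i) y) * sqrt (pmf (D' i) y))"
    using \<eta>2 S close by (intro prod_mono conjI affinity_lower) auto
  also have "\<dots> = (\<Sum>y\<in>PiE A S. \<Prod>i\<in>A. sqrt (pmf (D i) (y i)) * sqrt (pmf (D' i) (y i)))"
    using A S by (subst prod_sum_PiE) auto
  also have "\<dots> = (\<Sum>y\<in>PiE A S. sqrt (pmf (Pi_pmf A undefined D) y) * sqrt (pmf (Pi_pmf A undefined D') y))"
    using A by (intro sum.cong refl)
      (auto simp: pmf_Pi' PiE_def extensional_def prod.distrib real_sqrt_prod)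
  finally show ?thesis .
qed

lemma pmf_simplex_bind:
  assumes "p \<in> prob_simplex k"
  shows "pmf (p \<bind> Q) y = (\<Sum>x=1..k. pmf p x * pmf (Q x) y)"
  using assms unfolding pmf_bind
  by (subst integral_measure_pmf_real[of "{1..k}"]) (auto simp: prob_simplex_def mult_ac)

section \<open>Sensitivity of the output of a private channel\<close>

lemma ldp_le_mixture:
  assumes "ldp e k Q" "p \<in> prob_simplex k" "x \<in> {1..k}"
  shows "pmf (Q x) y \<le> exp e * pmf (p \<bind> Q) y"
proof -
  have "(\<Sum>a=1..k. pmf p a) = 1"
    using assms(2) by (intro sum_pmf_eq_1) (auto simp: prob_simplex_def)
  then have "pmf (Q x) y = (\<Sum>a=1..k. pmf p a * pmf (Q x) y)"
    by (simp flip: sum_distrib_right)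
  also have "\<dots> \<le> (\<Sum>a=1..k. pmf p a * (exp e * pmf (Q a) y))"
    using assms by (intro sum_mono mult_left_mono) (auto simp: ldp_def)
  also have "\<dots> = exp e * pmf (p \<bind> Q) y"
    using assms(2) by (simp add: pmf_simplex_bind sum_distrib_left mult_ac)
  finally show ?thesis .
qed

text \<open>Privacy bounds the difference by \<open>exp e - 1\<close>, of order \<open>e\<close>,
  times one row, and that row by \<open>exp e\<close> times any mixture. The bound is relative to
  the mixture's mass, as the affinity estimate needs.\<close>

lemma ldp_diff_le_mixture:
  assumes ldp: "ldp e k Q" and e: "0 < e" "e \<le> B"
    and p: "p \<in> prob_simplex k" and x: "x \<in> {1..k}" "x' \<in> {1..k}"
  shows "\<bar>pmf (Q x) y - pmf (Q x') y\<bar> \<le> e * exp (2 * B) * pmf (p \<bind> Q) y"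
proof -
  let ?a = "pmf (p \<bind> Q) y"
  have one: "pmf (Q u) y - pmf (Q v) y \<le> (exp e - 1) * (exp e * ?a)" if "u \<in> {1..k}" "v \<in> {1..k}" for u v
  proof -
    have "pmf (Q u) y - pmf (Q v) y \<le> (exp e - 1) * pmf (Q v) y"
      using ldp that by (simp add: ldp_def algebra_simps)
    also have "\<dots> \<le> (exp e - 1) * (exp e * ?a)"
      using e that by (intro mult_left_mono ldp_le_mixture[OF ldp p]) auto
    finally show ?thesis .
  qed
  have "1 - e \<le> exp (- e)" using exp_ge_add_one_self[of "- e"] by simp
  then have "(1 - e) * exp e \<le> exp (- e) * exp e" by (intro mult_right_mono) auto
  then have "exp e - 1 \<le> e * exp e" by (simp add: algebra_simps flip: exp_add)
  also have "\<dots> \<le> e * exp B" using e by simp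
  finally have "(exp e - 1) * (exp e * ?a) \<le> (e * exp B) * (exp B * ?a)"
    using e by (intro mult_mono) auto
  also have "\<dots> = e * exp (2 * B) * ?a" by (simp add: exp_double power2_eq_square)
  finally show ?thesis using one[OF x] one[OF x(2) x(1)] by linarith
qed

text \<open>The hypercube of Assouad's method: the masses of \<open>2l+1\<close> and \<open>2l+2\<close> are
  \<open>(1 \<plusminus> t)/(2m)\<close>, the sign being given by \<open>l \<in> V\<close>.\<close>

definition cube_pmf :: "nat \<Rightarrow> real \<Rightarrow> nat set \<Rightarrow> nat pmf" where
  "cube_pmf m t V = pmf_of_set {..<m} \<bind> (\<lambda>l. bernoulli_pmf (if l \<in> V then (1 + t) / 2 else (1 - t) / 2) \<bind>
     (\<lambda>b. return_pmf (if b then 2 * l + 1 else 2 * l + 2)))"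

lemma cube_pmf_simplex:
  assumes "0 < m" "2 * m \<le> k"
  shows "cube_pmf m t V \<in> prob_simplex k"
  using assms by (auto simp: prob_simplex_def cube_pmf_def lessThan_empty_iff split: if_splits)

lemma pmf_cube_bind:
  assumes "0 < m" "0 \<le> t" "t \<le> 1"
  shows "pmf (cube_pmf m t V \<bind> Q) y = (\<Sum>l<m. (if l \<in> V then (1 + t) / 2 else (1 - t) / 2) * pmf (Q (2 * l + 1)) y
     + (if l \<in> V then (1 - t) / 2 else (1 + t) / 2) * pmf (Q (2 * l + 2)) y) / m"
proof -
  have ne: "{..<m} \<noteq> {}" "finite {..<m}" using assms by auto
  have "cube_pmf m t V \<bind> Q = pmf_of_set {..<m} \<bind> (\<lambda>l. bernoulli_pmf (if l \<in> V then (1 + t) / 2 else (1 - t) / 2) \<bind>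
     (\<lambda>b. Q (if b then 2 * l + 1 else 2 * l + 2)))"
    by (simp add: cube_pmf_def bind_assoc_pmf bind_return_pmf)
  then show ?thesis
    using assms ne
    by (simp add: pmf_bind integral_pmf_of_set pmf_bind_bernoulli cong: if_cong)
       (auto intro!: sum.cong arg_cong[where f = "\<lambda>s. s / real m"] simp: field_simps split: if_splits)
qed

lemma pmf_cube_odd:
  assumes "0 < m" "0 \<le> t" "t \<le> 1" "l < m"
  shows "pmf (cube_pmf m t V) (2 * l + 1) = (if l \<in> V then (1 + t) / 2 else (1 - t) / 2) / m"
proof -
  have even_odd: "2 * i + 2 \<noteq> 2 * l + 1" for i by presburger
  have "pmf (cube_pmf m t V) (2 * l + 1) = pmf (cube_pmf m t V \<bind> return_pmf) (2 * l + 1)"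
    by (simp add: bind_return_pmf')
  also have "\<dots> = (\<Sum>i<m. if i = l then (if l \<in> V then (1 + t) / 2 else (1 - t) / 2) else 0) / m"
    unfolding pmf_cube_bind[OF assms(1-3)] using even_odd
    by (intro arg_cong[where f = "\<lambda>s. s / real m"] sum.cong refl) (auto split: split_indicator)
  also have "\<dots> = (if l \<in> V then (1 + t) / 2 else (1 - t) / 2) / m"
    using assms by simp
  finally show ?thesis .
qed

lemma pmf_cube_bind_insert:
  assumes "0 < m" "0 \<le> t" "t \<le> 1" "l < m" "l \<notin> V"
  shows "pmf (cube_pmf m t (insert l V) \<bind> Q) y - pmf (cube_pmf m t V \<bind> Q) y
    = t / m * (pmf (Q (2 * l + 1)) y - pmf (Q (2 * l + 2)) y)"
proof -
  have "pmf (cube_pmf m t (insert l V) \<bind> Q) y - pmf (cube_pmf m t V \<bind> Q) y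
    = (\<Sum>i<m. if i = l then t * (pmf (Q (2 * l + 1)) y - pmf (Q (2 * l + 2)) y) else 0) / m"
    unfolding pmf_cube_bind[OF assms(1-3)] diff_divide_distrib[symmetric] sum_subtractf[symmetric]
    using assms by (intro arg_cong[where f = "\<lambda>s. s / real m"] sum.cong refl) (auto simp: field_simps)
  also have "\<dots> = t / m * (pmf (Q (2 * l + 1)) y - pmf (Q (2 * l + 2)) y)"
    using assms by simp
  finally show ?thesis .
qed

text \<open>Groups the hypotheses into pairs that differ exactly in coordinate
  \<open>l\<close>.\<close>

lemma sum_Pow_pair:
  assumes "finite A" "l \<in> A"
  shows "(\<Sum>V\<in>Pow A. F V) = (\<Sum>V\<in>Pow (A - {l}). F V + F (insert l V) :: real)"
proof -
  have A: "A = insert l (A - {l})" using assms by auto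
  have "(\<Sum>V\<in>Pow A. F V) = (\<Sum>V\<in>Pow (A - {l}) \<union> insert l ` Pow (A - {l}). F V)"
    by (subst A, subst Pow_insert) simp
  also have "\<dots> = (\<Sum>V\<in>Pow (A - {l}). F V) + (\<Sum>V\<in>insert l ` Pow (A - {l}). F V)"
    using assms by (intro sum.union_disjoint) auto
  also have "(\<Sum>V\<in>insert l ` Pow (A - {l}). F V) = (\<Sum>V\<in>Pow (A - {l}). F (insert l V))"
    by (subst sum.reindex) (auto simp: inj_on_def)
  finally show ?thesis by (simp add: sum.distrib)
qed

lemma worst_case_risk_lower:
  fixes Q :: "nat \<Rightarrow> nat \<Rightarrow> 'y pmf"
  assumes e: "0 < e" "e \<le> B" and n: "n \<ge> 1" and k: "k \<ge> 2" and big: "real n * e\<^sup>2 \<ge> (real k)\<^sup>2"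
    and ldp: "\<And>i. i \<in> {1..n} \<Longrightarrow> ldp e k (Q i)"
  shows "ennreal (1 / (24 * exp (4 * B)) * (real k / (real n * e\<^sup>2))) \<le> worst_case_risk n k Q est"
proof -
  define m where "m = k div 2"
  \<comment> \<open>Chosen so that \<open>n * (\<Delta> * e * exp (2 * B))\<^sup>2 = 2\<close>, the
    largest value that \<open>affinity_Pi_pmf_lower\<close> admits.\<close>
  define \<Delta> where "\<Delta> = sqrt 2 / (sqrt (real n) * e * exp (2 * B))"
  \<comment> \<open>With this \<open>t\<close> the two possible masses of a symbol differ by
    \<open>t / m = \<Delta>\<close>.\<close>
  define t where "t = real m * \<Delta>"
  define p where "p = cube_pmf m t"
  define S where "S = (\<lambda>i. \<Union>x\<in>{1..k}. set_pmf (Q i x))"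
  let ?Y = "PiE {1..n} S"
  have m: "0 < m" "2 * m \<le> k" "k \<le> 3 * m" using k unfolding m_def by presburger+
  have \<Delta>: "\<Delta> > 0" using n e by (simp add: \<Delta>_def)
  have exp4: "(exp (2 * B))\<^sup>2 = exp (4 * B)"
    by (simp add: power2_eq_square flip: exp_add)
  have \<Delta>sq: "\<Delta>\<^sup>2 = 2 / (real n * e\<^sup>2 * exp (4 * B))"
    using n by (simp add: \<Delta>_def power_divide power_mult_distrib exp4)
  have t: "0 \<le> t" "t \<le> 1"
  proof -
    show "0 \<le> t" using \<Delta> by (simp add: t_def)
    \<comment> \<open>The assumption \<open>big\<close> enters here: the perturbation must leave all
      masses nonnegative.\<close>
    have "2 * (real m)\<^sup>2 \<le> (2 * real m)\<^sup>2" by (simp add: power_mult_distrib)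
    also have "\<dots> \<le> (real k)\<^sup>2" using m by (intro power_mono) auto
    also have "\<dots> \<le> real n * e\<^sup>2 * 1" using big by simp
    also have "\<dots> \<le> real n * e\<^sup>2 * exp (4 * B)" using e by (intro mult_left_mono) auto
    finally have "t\<^sup>2 \<le> 1" using n e by (simp add: t_def power_mult_distrib \<Delta>sq mult_ac)
    then show "t \<le> 1" using power2_le_imp_le[of t 1] by simp
  qed
  have p: "p V \<in> prob_simplex k" for V
    unfolding p_def using m by (intro cube_pmf_simplex) auto
  have finS: "finite (S i)" if "i \<in> {1..n}" for i
    using ldp[OF that] by (simp add: ldp_def S_def)
  have finY: "finite ?Y" using finS by (intro finite_PiE) auto
  have supp: "set_pmf (p V \<bind> Q i) \<subseteq> S i" for V i
    using p[of V] by (auto simp: prob_simplex_def S_def)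
  have suppY: "set_pmf (observation_law n Q (p V)) \<subseteq> ?Y" for V
  proof
    fix y assume "y \<in> set_pmf (observation_law n Q (p V))"
    then have "y \<in> PiE_dflt {1..n} undefined (set_pmf \<circ> (\<lambda>i. p V \<bind> Q i))"
      by (simp only: observation_law_def set_Pi_pmf finite_atLeastAtMost)
    then have "y i \<in> set_pmf (p V \<bind> Q i)" if "i \<in> {1..n}" for i
      using that by (auto simp: PiE_dflt_def simp del: set_bind_pmf)
    moreover have "y \<in> extensional {1..n}"
      using \<open>y \<in> PiE_dflt _ _ _\<close> by (auto simp: PiE_dflt_def extensional_def)
    ultimately show "y \<in> ?Y"
      using supp[of V] by (intro PiE_I) (blast, simp add: extensional_def)
  qed
  \<comment> \<open>The error in the odd symbol of pair \<open>l\<close>; distinct pairs concern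
    distinct symbols, so these losses add up to at most the risk.\<close>
  define loss where "loss V l = (\<Sum>y\<in>?Y. pmf (observation_law n Q (p V)) y * (est y (2 * l + 1) - pmf (p V) (2 * l + 1))\<^sup>2)"
    for V l
  have pair: "\<Delta>\<^sup>2 / 8 \<le> loss V l + loss (insert l V) l" if l: "l < m" "l \<notin> V" for V l
  proof -
    let ?A = "\<Sum>y\<in>?Y. sqrt (pmf (observation_law n Q (p V)) y) * sqrt (pmf (observation_law n Q (p (insert l V))) y)"
    \<comment> \<open>The free \<open>W\<close> lets either hypothesis serve as the reference
      mass.\<close>
    have close: "\<bar>pmf (p V \<bind> Q i) y - pmf (p (insert l V) \<bind> Q i) y\<bar> \<le> (\<Delta> * e * exp (2 * B)) * pmf (p W \<bind> Q i) y"
      if i: "i \<in> {1..n}" for i y W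
    proof -
      have "\<bar>pmf (p V \<bind> Q i) y - pmf (p (insert l V) \<bind> Q i) y\<bar>
          = \<Delta> * \<bar>pmf (Q i (2 * l + 1)) y - pmf (Q i (2 * l + 2)) y\<bar>"
        using pmf_cube_bind_insert[OF m(1) t l, of "Q i" y] m \<Delta>
        by (subst abs_minus_commute) (simp add: p_def t_def abs_mult)
      also have "\<dots> \<le> \<Delta> * (e * exp (2 * B) * pmf (p W \<bind> Q i) y)"
        using \<Delta> l m by (intro mult_left_mono ldp_diff_le_mixture[OF ldp[OF i] e p]) auto
      finally show ?thesis by (simp add: mult_ac)
    qed
    have "real (card {1..n}) * (\<Delta> * e * exp (2 * B))\<^sup>2 = 2"
      using n e by (simp add: power_mult_distrib \<Delta>sq exp4)
    then have A: "1 / 2 \<le> ?A"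
      unfolding observation_law_def using finS supp close
      by (intro affinity_Pi_pmf_lower[where \<eta> = "\<Delta> * e * exp (2 * B)"]) auto
    have diff: "pmf (p (insert l V)) (2 * l + 1) - pmf (p V) (2 * l + 1) = \<Delta>"
      unfolding p_def using l m by (subst (1 2) pmf_cube_odd[OF m(1) t]) (auto simp: t_def field_simps)
    \<comment> \<open>Affinity at least 1/2 and the two-point bound: a quarter of
      \<open>\<Delta>\<^sup>2\<close> is at most twice the summed losses.\<close>
    have "\<Delta>\<^sup>2 / 4 = (1 / 2 * \<Delta>)\<^sup>2" by (simp add: power_divide)
    also have "\<dots> \<le> (?A * \<Delta>)\<^sup>2" using A \<Delta> by (intro power_mono mult_right_mono) auto
    also have "\<dots> = (?A * (pmf (p V) (2 * l + 1) - pmf (p (insert l V)) (2 * l + 1)))\<^sup>2"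
      using diff by (simp add: power_mult_distrib flip: diff) (simp add: power2_commute)
    also have "\<dots> \<le> 2 * (loss V l + loss (insert l V) l)"
      unfolding loss_def using finY suppY by (intro two_point_bound)
    finally show ?thesis by simp
  qed
  have half: "2 ^ (m - 1) * (\<Delta>\<^sup>2 / 8) \<le> (\<Sum>V\<in>Pow {..<m}. loss V l)" if l: "l < m" for l
  proof -
    have "2 ^ (m - 1) * (\<Delta>\<^sup>2 / 8) = (\<Sum>V\<in>Pow ({..<m} - {l}). \<Delta>\<^sup>2 / 8)"
      using l by (simp add: card_Pow)
    also have "\<dots> \<le> (\<Sum>V\<in>Pow ({..<m} - {l}). loss V l + loss (insert l V) l)"
      using l by (intro sum_mono pair) auto
    also have "\<dots> = (\<Sum>V\<in>Pow {..<m}. loss V l)"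
      using l by (intro sum_Pow_pair[symmetric]) auto
    finally show ?thesis .
  qed
  \<comment> \<open>Some hypothesis has at least the average loss over all \<open>2 ^ m\<close>,
    which is at least \<open>m * 2 ^ (m - 1) * (\<Delta>\<^sup>2 / 8) / 2 ^ m\<close>.\<close>
  have "\<exists>V. real m * \<Delta>\<^sup>2 / 16 \<le> (\<Sum>l<m. loss V l)"
  proof (rule ccontr)
    assume "\<not> ?thesis"
    then have "(\<Sum>V\<in>Pow {..<m}. \<Sum>l<m. loss V l) < (\<Sum>V\<in>Pow {..<m}. real m * \<Delta>\<^sup>2 / 16)"
      by (intro sum_strict_mono) (auto simp: not_le)
    also have "\<dots> = (\<Sum>l<m. 2 ^ (m - 1) * (\<Delta>\<^sup>2 / 8))"
      using m by (cases m) (auto simp: card_Pow field_simps)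
    also have "\<dots> \<le> (\<Sum>l<m. \<Sum>V\<in>Pow {..<m}. loss V l)"
      using half by (intro sum_mono) auto
    also have "\<dots> = (\<Sum>V\<in>Pow {..<m}. \<Sum>l<m. loss V l)" by (rule sum.swap)
    finally show False by simp
  qed
  then obtain V where V: "real m * \<Delta>\<^sup>2 / 16 \<le> (\<Sum>l<m. loss V l)" by blast
  let ?P = "observation_law n Q (p V)"
  let ?L = "\<lambda>y. \<Sum>a=1..k. (est y a - pmf (p V) a)\<^sup>2"
  have "(\<Sum>l<m. loss V l) = (\<Sum>y\<in>?Y. pmf ?P y * (\<Sum>l<m. (est y (2 * l + 1) - pmf (p V) (2 * l + 1))\<^sup>2))"
    unfolding loss_def by (subst sum.swap) (simp add: sum_distrib_left)
  also have "\<dots> \<le> (\<Sum>y\<in>?Y. pmf ?P y * ?L y)"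
  proof (intro sum_mono mult_left_mono pmf_nonneg)
    fix y
    have "(\<Sum>l<m. (est y (2 * l + 1) - pmf (p V) (2 * l + 1))\<^sup>2)
        = (\<Sum>a\<in>(\<lambda>l. 2 * l + 1) ` {..<m}. (est y a - pmf (p V) a)\<^sup>2)"
      by (subst sum.reindex) (auto simp: inj_on_def)
    also have "\<dots> \<le> ?L y"
      using m by (intro sum_mono2) auto
    finally show "(\<Sum>l<m. (est y (2 * l + 1) - pmf (p V) (2 * l + 1))\<^sup>2) \<le> ?L y" .
  qed
  also have "\<dots> = measure_pmf.expectation ?P ?L"
    using finY suppY[of V] by (subst integral_measure_pmf_real[of ?Y]) (auto simp: mult_ac)
  finally have L: "real m * \<Delta>\<^sup>2 / 16 \<le> measure_pmf.expectation ?P ?L" using V by linarith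
  \<comment> \<open>The value of \<open>\<Delta>\<^sup>2\<close> leaves the constant 8 in the
    denominator, and \<open>k <= 3 * m\<close> turns it into 24; \<open>k = 3\<close>,
    \<open>m = 1\<close> is the extreme case.\<close>
  have "1 / (24 * exp (4 * B)) * (real k / (real n * e\<^sup>2)) \<le> 1 / (24 * exp (4 * B)) * (real (3 * m) / (real n * e\<^sup>2))"
    using m by (intro mult_left_mono divide_right_mono) auto
  also have "\<dots> = real m * \<Delta>\<^sup>2 / 16" using n e by (simp add: \<Delta>sq field_simps)
  also note L
  finally have "ennreal (1 / (24 * exp (4 * B)) * (real k / (real n * e\<^sup>2))) \<le> ennreal (measure_pmf.expectation ?P ?L)"
    by (rule ennreal_leI)
  also have "\<dots> = (\<integral>\<^sup>+ y. ennreal (?L y) \<partial>measure_pmf ?P)"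
    using finite_subset[OF suppY finY]
    by (intro nn_integral_eq_integral[symmetric] integrable_measure_pmf_finite AE_I2 sum_nonneg zero_le_power2)
  also have "\<dots> \<le> worst_case_risk n k Q est"
    unfolding worst_case_risk_def by (rule SUP_upper[OF p])
  finally show ?thesis .
qed

lemma minimax_risk_lower:
  assumes "0 < e" "e \<le> B" "n \<ge> 1" "k \<ge> 2" "real n * e\<^sup>2 \<ge> (real k)\<^sup>2"
  shows "ennreal (1 / (24 * exp (4 * B)) * (real k / (real n * e\<^sup>2))) \<le> minimax_risk e n k"
  unfolding minimax_risk_def using assms by (intro INF_greatest worst_case_risk_lower) auto

text \<open>Both constants depend on \<open>B\<close> alone. The lower bound excludes
  \<open>k = 1\<close>, where the simplex is a point and the minimax risk is zero, and small
  \<open>n\<close>, where the rate can exceed 1, the bound for the zero estimator.\<close>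

theorem theorem3:
  fixes B :: real
  assumes "B > 0"
  shows "\<exists>c>0. \<exists>C>0. \<forall>(d::nat) (\<epsilon> :: nat \<Rightarrow> real) (n::nat) (k::nat).
     d > 1 \<longrightarrow>
     strict_antimono_on {1..d} \<epsilon> \<longrightarrow>
     (\<forall>j\<in>{1..d}. 0 < \<epsilon> j \<and> \<epsilon> j \<le> B) \<longrightarrow>
     n \<ge> 1 \<longrightarrow> k \<ge> 1 \<longrightarrow>
     (\<exists>(K :: nat \<Rightarrow> nat pmf) (f :: nat \<Rightarrow> nat \<Rightarrow> nat \<Rightarrow> nat) (L :: nat \<Rightarrow> nat \<Rightarrow> nat \<Rightarrow> nat).
        (\<forall>i\<in>{1..n}. entropy_bits (K i) = (\<Sum>j=1..d. H2 (key_bit_prob \<epsilon> j))) \<and>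
        (\<forall>j\<in>{1..d}.
           (\<forall>i\<in>{1..n}. ldp (\<epsilon> j) k (analyst_view (K i) (f i) (L j i))) \<and>
           (\<exists>est. worst_case_risk n k (\<lambda>i. analyst_view (K i) (f i) (L j i)) est
                    \<le> ennreal (C * (real k / (real n * (\<epsilon> j)\<^sup>2)))))) \<and>
     (\<forall>j\<in>{1..d}.
        minimax_risk (\<epsilon> j) n k \<le> ennreal (C * (real k / (real n * (\<epsilon> j)\<^sup>2))) \<and>
        (k \<ge> 2 \<and> real n * (\<epsilon> j)\<^sup>2 \<ge> (real k)\<^sup>2 \<longrightarrow>
           ennreal (c * (real k / (real n * (\<epsilon> j)\<^sup>2))) \<le> minimax_risk (\<epsilon> j) n k))"
proof (rule exI[of _ "1 / (24 * exp (4 * B))"], rule conjI, simp, rule exI[of _ "risk_const B"],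
    rule conjI, goal_cases)
  case 1
  show ?case using assms by (simp add: risk_const_def add_pos_nonneg)
next
  case 2
  show ?case
    by (intro allI impI conjI ballI multi_level_mechanism minimax_risk_upper minimax_risk_lower) auto
qed

end
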